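(* For every $C>0$ there is a constant $C'>0$ depending only on $C$ such that the following holds for every $n$. Suppose $f,h\in \mathrm{LC}_g(\mathbb{R}^n)$ are such that $\tilde f(x)=f(x/z_f)$ and $\tilde h(x)=h(x/z_h)$ are in functional $M$-position with constant $C$, where $z_f=\left((2\pi)^{n/2}/\int f\right)^{1/n}$ and $z_h=\left((2\pi)^{n/2}/\int h\right)^{1/n}$. Then $$\left(\int f\star h\right)^{1/n}\le C'\left(\left(\int f\right)^{1/n}+\left(\int h\right)^{1/n}\right).$$
   Context: $\mathrm{LC}_g(\mathbb{R}^n)$ is the class of geometric log-concave functions: upper semi-continuous $f:\mathbb{R}^n\to[0,1]$ with $-\log f$ convex (values in $[0,\infty]$), $\max f=f(0)=1$, and $0<\int f<\infty$. $(f\star h)(x)=\sup_{z} f(z)h(x-z)$. $g_0(x)=\exp(-|x|^2/2)$. For $f=e^{-\varphi}$, $f^*=e^{-\mathcal{L}\varphi}$ with $\mathcal{L}\varphi(y)=\sup_{x}(\langle y,x\rangle-\varphi(x))$. The functional covering number is $N(f,g)=\inf\{\mu(\mathbb{R}^n)\}$ over all non-negative Borel measures $\mu$ on $\mathbb{R}^n$ with $(\mu*g)(x)=\int g(x-t)\,d\mu(t)\ge f(x)$ for all $x$. A function $u\in \mathrm{LC}_g(\mathbb{R}^n)$ is in functional $M$-position with constant $C$ if it satisfies either of the following two conditions (the statement holds for either choice): (volume) $\int u=(2\pi)^{n/2}$ and for every $\psi\in \mathrm{LC}_g(\mathbb{R}^n)$, $C^{-n}\int g_0\star \psi\le\int u\star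 \psi\le C^n\int g_0\star \psi$ and $C^{-n}\int g_0\star \psi\le\int u^*\star \psi\le C^n\int g_0\star \psi$; (covering) $\int u=(2\pi)^{n/2}$ and each of $N(u,g_0),N(g_0,u),N(u^*,g_0),N(g_0,u^* )$ is at most $C^n$. *)

theory Defs
  imports "HOL-Analysis.Analysis"
begin

(* The dimension n has to be quantified inside a formula, after a constant that must not depend
   on it, so R^n is not a type here: its points are the extensional functions on {..<n}, as in
   PiM and product_topology, and a function on R^n is an HOL function whose values outside of
   Rn n are irrelevant. *)

abbreviation Rn :: "nat \<Rightarrow> (nat \<Rightarrow> real) set" where
  "Rn n \<equiv> {..<n} \<rightarrow>\<^sub>E UNIV"

abbreviation top_Rn :: "nat \<Rightarrow> (nat \<Rightarrow> real) topology" where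
  "top_Rn n \<equiv> product_topology (\<lambda>_. euclideanreal) {..<n}"

abbreviation lborel_Rn :: "nat \<Rightarrow> (nat \<Rightarrow> real) measure" where
  "lborel_Rn n \<equiv> Pi\<^sub>M {..<n} (\<lambda>_. lborel)"

definition zero_Rn :: "nat \<Rightarrow> nat \<Rightarrow> real" where
  "zero_Rn n = (\<lambda>i\<in>{..<n}. 0)"

definition add_Rn :: "nat \<Rightarrow> (nat \<Rightarrow> real) \<Rightarrow> (nat \<Rightarrow> real) \<Rightarrow> nat \<Rightarrow> real" where
  "add_Rn n x y = (\<lambda>i\<in>{..<n}. x i + y i)"

definition diff_Rn :: "nat \<Rightarrow> (nat \<Rightarrow> real) \<Rightarrow> (nat \<Rightarrow> real) \<Rightarrow> nat \<Rightarrow> real" where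
  "diff_Rn n x y = (\<lambda>i\<in>{..<n}. x i - y i)"

definition scale_Rn :: "nat \<Rightarrow> real \<Rightarrow> (nat \<Rightarrow> real) \<Rightarrow> nat \<Rightarrow> real" where
  "scale_Rn n a x = (\<lambda>i\<in>{..<n}. a * x i)"

definition inner_Rn :: "nat \<Rightarrow> (nat \<Rightarrow> real) \<Rightarrow> (nat \<Rightarrow> real) \<Rightarrow> real" where
  "inner_Rn n x y = (\<Sum>i<n. x i * y i)"

definition usc_Rn :: "nat \<Rightarrow> ((nat \<Rightarrow> real) \<Rightarrow> real) \<Rightarrow> bool" where
  "usc_Rn n f \<longleftrightarrow> (\<forall>c. openin (top_Rn n) {x \<in> Rn n. f x < c})"

definition convex_Rn :: "nat \<Rightarrow> ((nat \<Rightarrow> real) \<Rightarrow> ereal) \<Rightarrow> bool" where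
  "convex_Rn n \<phi> \<longleftrightarrow> (\<forall>x\<in>Rn n. \<forall>y\<in>Rn n. \<forall>t\<in>{0..1}.
     \<phi> (add_Rn n (scale_Rn n (1 - t) x) (scale_Rn n t y)) \<le> ereal (1 - t) * \<phi> x + ereal t * \<phi> y)"

definition neg_log :: "real \<Rightarrow> ereal" where
  "neg_log a = (if a = 0 then \<infinity> else ereal (- ln a))"

(* The value at -\<infinity>, where exp (-a) would be infinite, is junk. It is never used below: the
   Legendre transform of -log u is non-negative as soon as u 0 = 1. *)
definition exp_neg :: "ereal \<Rightarrow> real" where
  "exp_neg a = (if a = \<infinity> then 0 else exp (- real_of_ereal a))"

(* Integrals take values in ennreal, since some of those that occur can be infinite, for example
   that of polar n u when 0 is on the boundary of the support of u. *)
definition mass :: "nat \<Rightarrow> ((nat \<Rightarrow> real) \<Rightarrow> real) \<Rightarrow> ennreal" where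
  "mass n f = (\<integral>\<^sup>+x. ennreal (f x) \<partial>lborel_Rn n)"

definition LCg :: "nat \<Rightarrow> ((nat \<Rightarrow> real) \<Rightarrow> real) set" where
  "LCg n = {f. (\<forall>x\<in>Rn n. 0 \<le> f x \<and> f x \<le> 1) \<and> usc_Rn n f \<and> convex_Rn n (\<lambda>x. neg_log (f x)) \<and>
               f (zero_Rn n) = 1 \<and> 0 < mass n f \<and> mass n f < \<infinity>}"

(* Only for functions with values in [0,1], so that the real supremum is a genuine one. *)
definition sup_conv ::
    "nat \<Rightarrow> ((nat \<Rightarrow> real) \<Rightarrow> real) \<Rightarrow> ((nat \<Rightarrow> real) \<Rightarrow> real) \<Rightarrow> (nat \<Rightarrow> real) \<Rightarrow> real" where
  "sup_conv n f h x = (SUP z\<in>Rn n. f z * h (diff_Rn n x z))"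

definition gauss :: "nat \<Rightarrow> (nat \<Rightarrow> real) \<Rightarrow> real" where
  "gauss n x = exp (- inner_Rn n x x / 2)"

definition legendre :: "nat \<Rightarrow> ((nat \<Rightarrow> real) \<Rightarrow> ereal) \<Rightarrow> (nat \<Rightarrow> real) \<Rightarrow> ereal" where
  "legendre n \<phi> y = (SUP x\<in>Rn n. ereal (inner_Rn n y x) - \<phi> x)"

definition polar :: "nat \<Rightarrow> ((nat \<Rightarrow> real) \<Rightarrow> real) \<Rightarrow> (nat \<Rightarrow> real) \<Rightarrow> real" where
  "polar n f y = exp_neg (legendre n (\<lambda>x. neg_log (f x)) y)"

definition covering_number ::
    "nat \<Rightarrow> ((nat \<Rightarrow> real) \<Rightarrow> real) \<Rightarrow> ((nat \<Rightarrow> real) \<Rightarrow> real) \<Rightarrow> ennreal" where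
  "covering_number n f g =
     (INF \<mu>\<in>{\<mu>. sets \<mu> = sets (lborel_Rn n) \<and>
                 (\<forall>x\<in>Rn n. ennreal (f x) \<le> (\<integral>\<^sup>+t. ennreal (g (diff_Rn n x t)) \<partial>\<mu>))}.
        emeasure \<mu> (Rn n))"

definition M_volume :: "nat \<Rightarrow> real \<Rightarrow> ((nat \<Rightarrow> real) \<Rightarrow> real) \<Rightarrow> bool" where
  "M_volume n C u \<longleftrightarrow>
     mass n u = ennreal ((2 * pi) powr (real n / 2)) \<and>
     (\<forall>\<psi>\<in>LCg n. \<forall>v\<in>{u, polar n u}.
        ennreal (inverse (C ^ n)) * mass n (sup_conv n (gauss n) \<psi>) \<le> mass n (sup_conv n v \<psi>) \<and>
        mass n (sup_conv n v \<psi>) \<le> ennreal (C ^ n) * mass n (sup_conv n (gauss n) \<psi>))"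

definition M_covering :: "nat \<Rightarrow> real \<Rightarrow> ((nat \<Rightarrow> real) \<Rightarrow> real) \<Rightarrow> bool" where
  "M_covering n C u \<longleftrightarrow>
     mass n u = ennreal ((2 * pi) powr (real n / 2)) \<and>
     covering_number n u (gauss n) \<le> ennreal (C ^ n) \<and>
     covering_number n (gauss n) u \<le> ennreal (C ^ n) \<and>
     covering_number n (polar n u) (gauss n) \<le> ennreal (C ^ n) \<and>
     covering_number n (gauss n) (polar n u) \<le> ennreal (C ^ n)"

definition M_position :: "nat \<Rightarrow> real \<Rightarrow> ((nat \<Rightarrow> real) \<Rightarrow> real) \<Rightarrow> bool" where
  "M_position n C u \<longleftrightarrow> u \<in> LCg n \<and> (M_volume n C u \<or> M_covering n C u)"

definition norm_factor :: "nat \<Rightarrow> ((nat \<Rightarrow> real) \<Rightarrow> real) \<Rightarrow> real" where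
  "norm_factor n f = ((2 * pi) powr (real n / 2) / enn2real (mass n f)) powr (1 / real n)"

definition normalized :: "nat \<Rightarrow> ((nat \<Rightarrow> real) \<Rightarrow> real) \<Rightarrow> (nat \<Rightarrow> real) \<Rightarrow> real" where
  "normalized n f x = f (scale_Rn n (1 / norm_factor n f) x)"

end

theory Submission
  imports Defs "HOL-Probability.Distributions"
begin

text \<open>Since \<open>f\<close> does not decrease when its argument is shrunk towards the origin, \<open>f\<close> and \<open>h\<close> are
  dominated by their normalizations dilated by the common factor \<open>s = 1 / z_f + 1 / z_h\<close>, so the
  integral of \<open>f \<star> h\<close> is at most \<open>s^n\<close> times that of the sup-convolution of the normalizations.
  In that one, each factor can be exchanged for the Gaussian at the cost of \<open>(C + 1)^n\<close>: directly by
  the volume condition, or, if \<open>u \<le> \<mu> * g_0\<close>, because \<open>u \<star> v \<le> \<mu> * (g_0 \<star> v)\<close> and convolution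
  multiplies masses. What remains is \<open>g_0 \<star> g_0\<close>, which is bounded by \<open>exp (- |x|^2 / 4)\<close>.\<close>

section \<open>Coordinatewise vector operations and their measurability\<close>

lemma space_lborel_Rn [simp]: "space (lborel_Rn n) = Rn n"
  by (simp add: space_PiM)

lemma
  shows zero_Rn_in: "zero_Rn n \<in> Rn n"
    and diff_Rn_in: "diff_Rn n x y \<in> Rn n"
    and scale_Rn_in: "scale_Rn n a x \<in> Rn n"
  by (auto simp: zero_Rn_def diff_Rn_def scale_Rn_def)

lemma diff_Rn_diff_Rn: "z \<in> Rn n \<Longrightarrow> diff_Rn n x (diff_Rn n x z) = z"
  by (auto simp: diff_Rn_def PiE_def extensional_def fun_eq_iff)

lemma scale_Rn_scale_Rn: "scale_Rn n a (scale_Rn n b x) = scale_Rn n (a * b) x"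
  by (auto simp: scale_Rn_def)

lemma scale_Rn_one: "x \<in> Rn n \<Longrightarrow> scale_Rn n 1 x = x"
  by (auto simp: scale_Rn_def PiE_def extensional_def)

lemma measurable_diff_Rn [measurable]:
  assumes "f \<in> M \<rightarrow>\<^sub>M lborel_Rn n" "g \<in> M \<rightarrow>\<^sub>M lborel_Rn n"
  shows "(\<lambda>x. diff_Rn n (f x) (g x)) \<in> M \<rightarrow>\<^sub>M lborel_Rn n"
proof -
  have [measurable]: "(\<lambda>x. f x i) \<in> borel_measurable M" "(\<lambda>x. g x i) \<in> borel_measurable M"
    if "i < n" for i
    using measurable_compose[OF assms(1) measurable_component_singleton[of i]]
      measurable_compose[OF assms(2) measurable_component_singleton[of i]] that by auto
  show ?thesis
    unfolding diff_Rn_def by (rule measurable_restrict) auto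
qed

lemma measurable_scale_Rn [measurable]: "scale_Rn n a \<in> lborel_Rn n \<rightarrow>\<^sub>M lborel_Rn n"
  unfolding scale_Rn_def
proof (rule measurable_restrict)
  fix i assume "i \<in> {..<n}"
  then have [measurable]: "(\<lambda>x. x i) \<in> borel_measurable (lborel_Rn n)"
    using measurable_component_singleton[of i "{..<n}" "\<lambda>_. lborel"] by simp
  show "(\<lambda>x. a * x i) \<in> lborel_Rn n \<rightarrow>\<^sub>M lborel" by simp
qed

lemma measurable_inner_Rn [measurable]: "(\<lambda>x. inner_Rn n x x) \<in> borel_measurable (lborel_Rn n)"
  unfolding inner_Rn_def
proof (rule borel_measurable_sum)
  fix i assume "i \<in> {..<n}"
  then have [measurable]: "(\<lambda>x. x i) \<in> borel_measurable (lborel_Rn n)"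
    using measurable_component_singleton[of i "{..<n}" "\<lambda>_. lborel"] by simp
  show "(\<lambda>x. x i * x i) \<in> borel_measurable (lborel_Rn n)" by simp
qed

lemma measurable_gauss [measurable]: "gauss n \<in> borel_measurable (lborel_Rn n)"
  unfolding gauss_def by measurable

section \<open>Lebesgue measure under dilations and translations\<close>

text \<open>A product measure is determined by its values on boxes, and there each of the
  \<open>n\<close> coordinates contributes a factor \<open>\<bar>c\<bar>\<close> by the
  one-dimensional formula. Zero shift gives the dilation rule, \<open>c = 1\<close> the translation
  rule.\<close>

lemma lborel_Rn_affine:
  assumes "c \<noteq> 0"
  shows "lborel_Rn n = density (distr (lborel_Rn n) (lborel_Rn n) (\<lambda>x. \<lambda>i\<in>{..<n}. t i + c * x i))
    (\<lambda>_. ennreal (\<bar>c\<bar> ^ n))"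
proof -
  interpret product_sigma_finite "\<lambda>_::nat. lborel :: real measure" ..
  let ?T = "\<lambda>x. \<lambda>i\<in>{..<n}. t i + c * x i"
  have T [measurable]: "?T \<in> lborel_Rn n \<rightarrow>\<^sub>M lborel_Rn n"
  proof (rule measurable_restrict)
    fix i assume "i \<in> {..<n}"
    then have [measurable]: "(\<lambda>x. x i) \<in> borel_measurable (lborel_Rn n)"
      using measurable_component_singleton[of i "{..<n}" "\<lambda>_. lborel"] by simp
    show "(\<lambda>x. t i + c * x i) \<in> lborel_Rn n \<rightarrow>\<^sub>M lborel" by simp
  qed
  show ?thesis
  proof (rule PiM_eqI[symmetric])
    fix A :: "nat \<Rightarrow> real set" assume "\<And>i. i \<in> {..<n} \<Longrightarrow> A i \<in> sets lborel"
    then have A: "A i \<in> sets borel" if "i < n" for i using that by simp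
    let ?B = "\<lambda>i. (\<lambda>x. t i + c * x) -` A i"
    have B: "?B i \<in> sets borel" if "i < n" for i
    proof -
      have "(\<lambda>x. t i + c * x) \<in> borel \<rightarrow>\<^sub>M borel" by simp
      from measurable_sets[OF this A[OF that]] show ?thesis by simp
    qed
    have PA: "Pi\<^sub>E {..<n} A \<in> sets (lborel_Rn n)"
      using A by (intro sets_PiM_I_finite) auto
    have pre: "?T -` (Pi\<^sub>E {..<n} A) \<inter> space (lborel_Rn n) = Pi\<^sub>E {..<n} ?B"
      by (auto simp: space_PiM PiE_iff extensional_def)
    have one: "emeasure lborel (A i) = ennreal \<bar>c\<bar> * emeasure lborel (?B i)" if "i < n" for i
    proof -
      have "emeasure lborel (A i)
          = emeasure (density (distr lborel borel (\<lambda>x. t i + c * x)) (\<lambda>_. ennreal \<bar>c\<bar>)) (A i)"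
        using lborel_real_affine[OF assms, of "t i"] by simp
      also have "\<dots> = ennreal \<bar>c\<bar> * emeasure lborel (?B i)"
        using A[OF that] by (subst emeasure_density_const) (auto simp: emeasure_distr)
      finally show ?thesis .
    qed
    have "emeasure (density (distr (lborel_Rn n) (lborel_Rn n) ?T) (\<lambda>_. ennreal (\<bar>c\<bar> ^ n))) (Pi\<^sub>E {..<n} A)
        = ennreal (\<bar>c\<bar> ^ n) * emeasure (lborel_Rn n) (Pi\<^sub>E {..<n} ?B)"
      using PA by (subst emeasure_density_const) (simp_all add: emeasure_distr pre del: space_lborel_Rn)
    also have "\<dots> = ennreal (\<bar>c\<bar> ^ n) * (\<Prod>i<n. emeasure lborel (?B i))"
      using B by (subst emeasure_PiM) auto
    also have "\<dots> = (\<Prod>i<n. ennreal \<bar>c\<bar> * emeasure lborel (?B i))"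
      by (simp add: prod.distrib ennreal_power)
    also have "\<dots> = (\<Prod>i<n. emeasure lborel (A i))"
      using one by (intro prod.cong) auto
    finally show "emeasure (density (distr (lborel_Rn n) (lborel_Rn n) ?T) (\<lambda>_. ennreal (\<bar>c\<bar> ^ n)))
      (Pi\<^sub>E {..<n} A) = (\<Prod>i<n. emeasure lborel (A i))" .
  qed auto
qed

lemma nn_integral_lborel_Rn_scale:
  assumes "c > 0" and [measurable]: "F \<in> borel_measurable (lborel_Rn n)"
  shows "(\<integral>\<^sup>+x. F x \<partial>lborel_Rn n) = ennreal (c ^ n) * (\<integral>\<^sup>+x. F (scale_Rn n c x) \<partial>lborel_Rn n)"
proof -
  have T: "(\<lambda>x. \<lambda>i\<in>{..<n}. 0 + c * x i) = scale_Rn n c"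
    by (auto simp: scale_Rn_def)
  have "(\<integral>\<^sup>+x. F x \<partial>lborel_Rn n) = (\<integral>\<^sup>+x. F x \<partial>density
      (distr (lborel_Rn n) (lborel_Rn n) (scale_Rn n c)) (\<lambda>_. ennreal (c ^ n)))"
    using lborel_Rn_affine[of c n "\<lambda>_. 0"] assms(1) unfolding T by simp
  also have "\<dots> = ennreal (c ^ n) * (\<integral>\<^sup>+x. F (scale_Rn n c x) \<partial>lborel_Rn n)"
    by (simp add: nn_integral_density nn_integral_distr nn_integral_cmult)
  finally show ?thesis .
qed

lemma nn_integral_lborel_Rn_diff:
  assumes [measurable]: "F \<in> borel_measurable (lborel_Rn n)" and t: "t \<in> Rn n"
  shows "(\<integral>\<^sup>+x. F (diff_Rn n x t) \<partial>lborel_Rn n) = (\<integral>\<^sup>+x. F x \<partial>lborel_Rn n)"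
proof -
  have T: "(\<lambda>x. \<lambda>i\<in>{..<n}. - t i + 1 * x i) = (\<lambda>x. diff_Rn n x t)"
    by (auto simp: diff_Rn_def)
  have "t \<in> space (lborel_Rn n)" using t by simp
  then have [measurable]: "(\<lambda>x. diff_Rn n x t) \<in> lborel_Rn n \<rightarrow>\<^sub>M lborel_Rn n"
    by measurable
  have "(\<integral>\<^sup>+x. F x \<partial>lborel_Rn n) = (\<integral>\<^sup>+x. F x \<partial>density
      (distr (lborel_Rn n) (lborel_Rn n) (\<lambda>x. diff_Rn n x t)) (\<lambda>_. 1))"
    using lborel_Rn_affine[of 1 n "\<lambda>i. - t i"] unfolding T by simp
  also have "\<dots> = (\<integral>\<^sup>+x. F (diff_Rn n x t) \<partial>lborel_Rn n)"
    by (simp add: nn_integral_density nn_integral_distr del: density_1)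
  finally show ?thesis by simp
qed

text \<open>The integrand need not be measurable (a sup-convolution is not obviously so), hence the
  reduction to simple functions.\<close>
lemma mass_scale_le:
  assumes c: "c > 0"
  shows "mass n (\<lambda>x. F (scale_Rn n (1 / c) x)) \<le> ennreal (c ^ n) * mass n F"
  unfolding mass_def
proof (subst (1) nn_integral_def, rule SUP_least, clarify)
  fix g assume g: "simple_function (lborel_Rn n) g" "g \<le> (\<lambda>x. ennreal (F (scale_Rn n (1 / c) x)))"
  have [measurable]: "g \<in> borel_measurable (lborel_Rn n)"
    using g(1) by (rule borel_measurable_simple_function)
  have "integral\<^sup>S (lborel_Rn n) g = (\<integral>\<^sup>+x. g x \<partial>lborel_Rn n)"
    using g(1) by (simp add: nn_integral_eq_simple_integral)
  also have "\<dots> = ennreal (c ^ n) * (\<integral>\<^sup>+x. g (scale_Rn n c x) \<partial>lborel_Rn n)"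
    using c by (intro nn_integral_lborel_Rn_scale) auto
  also have "\<dots> \<le> ennreal (c ^ n) * (\<integral>\<^sup>+x. ennreal (F x) \<partial>lborel_Rn n)"
  proof (intro mult_left_mono nn_integral_mono)
    fix x assume "x \<in> space (lborel_Rn n)"
    then have "scale_Rn n (1 / c) (scale_Rn n c x) = x"
      using c by (simp add: scale_Rn_scale_Rn scale_Rn_one)
    then show "g (scale_Rn n c x) \<le> ennreal (F x)"
      using le_funD[OF g(2), of "scale_Rn n c x"] by simp
  qed simp
  finally show "integral\<^sup>S (lborel_Rn n) g \<le> ennreal (c ^ n) * (\<integral>\<^sup>+x. ennreal (F x) \<partial>lborel_Rn n)" .
qed

section \<open>Sup-convolution and its domination through a covering measure\<close>

text \<open>The substitution of \<open>x - z\<close> for \<open>z\<close> is an involution of the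
  index set that swaps the two factors.\<close>

lemma sup_conv_commute:
  assumes x: "x \<in> Rn n"
  shows "sup_conv n f h x = sup_conv n h f x"
proof -
  have "(\<lambda>z. f z * h (diff_Rn n x z)) ` Rn n = (\<lambda>z. h z * f (diff_Rn n x z)) ` Rn n"
  proof (intro equalityI image_subsetI)
    fix z assume z: "z \<in> Rn n"
    then show "f z * h (diff_Rn n x z) \<in> (\<lambda>z. h z * f (diff_Rn n x z)) ` Rn n"
      by (intro image_eqI[of _ _ "diff_Rn n x z"]) (auto simp: diff_Rn_diff_Rn diff_Rn_in)
    show "h z * f (diff_Rn n x z) \<in> (\<lambda>z. f z * h (diff_Rn n x z)) ` Rn n"
      using z by (intro image_eqI[of _ _ "diff_Rn n x z"]) (auto simp: diff_Rn_diff_Rn diff_Rn_in)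
  qed
  then show ?thesis unfolding sup_conv_def by simp
qed

lemma mass_sup_conv_commute: "mass n (sup_conv n f h) = mass n (sup_conv n h f)"
  unfolding mass_def by (intro nn_integral_cong) (simp add: sup_conv_commute)

text \<open>The bound lives in \<open>ennreal\<close> because it will be an integral that may a
  priori be infinite. A finite bound reduces to the real supremum over a non-empty set.\<close>

lemma sup_conv_least:
  assumes "\<And>z. z \<in> Rn n \<Longrightarrow> ennreal (f z * h (diff_Rn n x z)) \<le> c"
  shows "ennreal (sup_conv n f h x) \<le> c"
proof (cases c)
  case (real r)
  have "sup_conv n f h x \<le> r"
    unfolding sup_conv_def
  proof (rule cSUP_least)
    show "Rn n \<noteq> {}" using zero_Rn_in by blast
    fix z assume "z \<in> Rn n"
    then show "f z * h (diff_Rn n x z) \<le> r"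
      using assms[of z] real by (simp add: ennreal_le_iff)
  qed
  then show ?thesis using real by (simp add: ennreal_leI)
qed simp

text \<open>The pointwise part of membership in \<open>LCg\<close>: the upper bound makes the real
  supremum in \<open>sup_conv\<close> genuine, and the sign allows products to be compared factor by
  factor.\<close>

definition unit_valued :: "nat \<Rightarrow> ((nat \<Rightarrow> real) \<Rightarrow> real) \<Rightarrow> bool" where
  "unit_valued n f \<longleftrightarrow> (\<forall>x\<in>Rn n. 0 \<le> f x \<and> f x \<le> 1)"

lemma sup_conv_upper:
  assumes "unit_valued n f" "unit_valued n h" "z \<in> Rn n"
  shows "f z * h (diff_Rn n x z) \<le> sup_conv n f h x"
  unfolding sup_conv_def
proof (rule cSUP_upper)
  show "bdd_above ((\<lambda>z. f z * h (diff_Rn n x z)) ` Rn n)"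
    using assms(1,2) by (intro bdd_aboveI2[where M = 1])
      (auto simp: unit_valued_def diff_Rn_in intro!: mult_le_one)
qed fact

lemma inner_Rn_nonneg: "0 \<le> inner_Rn n x x"
  unfolding inner_Rn_def by (intro sum_nonneg) simp

lemma unit_valued_gauss: "unit_valued n (gauss n)"
  using inner_Rn_nonneg by (simp add: unit_valued_def gauss_def)

lemma LCg_unit_valued: "f \<in> LCg n \<Longrightarrow> unit_valued n f"
  by (simp add: LCg_def unit_valued_def)

text \<open>The majorant \<open>H\<close> stands in for \<open>g_0 \<star> v\<close>, whose measurability would be needed for Tonelli.\<close>
lemma sup_conv_covering_le:
  assumes sets: "sets \<mu> = sets (lborel_Rn n)"
    and cov: "\<And>x. x \<in> Rn n \<Longrightarrow> ennreal (u x) \<le> (\<integral>\<^sup>+t. ennreal (gauss n (diff_Rn n x t)) \<partial>\<mu>)"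
    and u: "unit_valued n u" and v: "unit_valued n v"
    and H: "\<And>x. x \<in> Rn n \<Longrightarrow> ennreal (sup_conv n (gauss n) v x) \<le> H x"
    and x: "x \<in> Rn n"
  shows "ennreal (sup_conv n u v x) \<le> (\<integral>\<^sup>+t. H (diff_Rn n x t) \<partial>\<mu>)"
proof (rule sup_conv_least)
  fix z assume z: "z \<in> Rn n"
  have [measurable]: "(\<lambda>t. gauss n (diff_Rn n z t)) \<in> borel_measurable \<mu>"
  proof -
    have "z \<in> space (lborel_Rn n)" using z by simp
    then have "(\<lambda>t. gauss n (diff_Rn n z t)) \<in> borel_measurable (lborel_Rn n)" by measurable
    then show ?thesis using measurable_cong_sets[OF sets refl] by blast
  qed
  have vnn: "0 \<le> v (diff_Rn n x z)" using v by (simp add: unit_valued_def diff_Rn_in)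
  have unn: "0 \<le> u z" using u z by (simp add: unit_valued_def)
  have "ennreal (u z * v (diff_Rn n x z)) = ennreal (u z) * ennreal (v (diff_Rn n x z))"
    using vnn unn by (simp add: ennreal_mult)
  also have "\<dots> \<le> (\<integral>\<^sup>+t. ennreal (gauss n (diff_Rn n z t)) \<partial>\<mu>) * ennreal (v (diff_Rn n x z))"
    by (intro mult_right_mono cov z) simp
  also have "\<dots> = (\<integral>\<^sup>+t. ennreal (gauss n (diff_Rn n z t)) * ennreal (v (diff_Rn n x z)) \<partial>\<mu>)"
    by (rule nn_integral_multc[symmetric]) measurable
  also have "\<dots> \<le> (\<integral>\<^sup>+t. H (diff_Rn n x t) \<partial>\<mu>)"
  proof (rule nn_integral_mono)
    fix t
    have "diff_Rn n (diff_Rn n x t) (diff_Rn n z t) = diff_Rn n x z"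
      by (auto simp: diff_Rn_def)
    \<comment> \<open>The competitor in the supremum at \<open>x - t\<close> is
      \<open>z - t\<close>; what remains for \<open>v\<close> is \<open>x - z\<close>, independently
      of \<open>t\<close>.\<close>
    then have "gauss n (diff_Rn n z t) * v (diff_Rn n x z) \<le> sup_conv n (gauss n) v (diff_Rn n x t)"
      using sup_conv_upper[OF unit_valued_gauss v diff_Rn_in[of n z t], of "diff_Rn n x t"] by simp
    then have "ennreal (gauss n (diff_Rn n z t) * v (diff_Rn n x z)) \<le> H (diff_Rn n x t)"
      using H[OF diff_Rn_in, of x t] by (meson ennreal_leI order_trans)
    then show "ennreal (gauss n (diff_Rn n z t)) * ennreal (v (diff_Rn n x z)) \<le> H (diff_Rn n x t)"
      using vnn by (simp add: ennreal_mult gauss_def)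
  qed
  finally show "ennreal (u z * v (diff_Rn n x z)) \<le> (\<integral>\<^sup>+t. H (diff_Rn n x t) \<partial>\<mu>)" .
qed

section \<open>Convolution with a finite measure\<close>

lemma sigma_finite_lborel_Rn: "sigma_finite_measure (lborel_Rn n)"
proof -
  interpret product_sigma_finite "\<lambda>_::nat. lborel :: real measure" ..
  show ?thesis by (rule sigma_finite) simp
qed

text \<open>Tonelli followed by translation invariance of the inner integral. Finiteness of
  \<open>\<mu>\<close> supplies the sigma-finiteness that exchanging the integrals requires.\<close>

lemma
  assumes sets: "sets \<mu> = sets (lborel_Rn n)" and fin: "emeasure \<mu> (Rn n) < \<infinity>"
    and H: "H \<in> borel_measurable (lborel_Rn n)"
  shows measurable_convolution: "(\<lambda>x. \<integral>\<^sup>+t. H (diff_Rn n x t) \<partial>\<mu>) \<in> borel_measurable (lborel_Rn n)"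
    and nn_integral_convolution: "(\<integral>\<^sup>+x. \<integral>\<^sup>+t. H (diff_Rn n x t) \<partial>\<mu> \<partial>lborel_Rn n)
      = emeasure \<mu> (Rn n) * (\<integral>\<^sup>+x. H x \<partial>lborel_Rn n)"
proof -
  have sp: "space \<mu> = Rn n" using sets_eq_imp_space_eq[OF sets] by simp
  interpret \<mu>: finite_measure \<mu> using fin by (intro finite_measureI) (simp add: sp)
  interpret L: sigma_finite_measure "lborel_Rn n" by (rule sigma_finite_lborel_Rn)
  interpret P: pair_sigma_finite "lborel_Rn n" \<mu> ..
  note H[measurable]
  have "(\<lambda>(x, t). H (diff_Rn n x t)) \<in> borel_measurable (lborel_Rn n \<Otimes>\<^sub>M lborel_Rn n)"
    by measurable
  \<comment> \<open>Only the sigma-algebra of \<open>\<mu>\<close> matters for measurability, and it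
    is that of \<open>lborel_Rn n\<close>.\<close>
  then have m [measurable]: "(\<lambda>(x, t). H (diff_Rn n x t)) \<in> borel_measurable (lborel_Rn n \<Otimes>\<^sub>M \<mu>)"
    using measurable_cong_sets[OF sets_pair_measure_cong[OF refl sets] refl] by blast
  show "(\<lambda>x. \<integral>\<^sup>+t. H (diff_Rn n x t) \<partial>\<mu>) \<in> borel_measurable (lborel_Rn n)"
    using \<mu>.borel_measurable_nn_integral_fst[OF m] by simp
  have "(\<integral>\<^sup>+x. \<integral>\<^sup>+t. H (diff_Rn n x t) \<partial>\<mu> \<partial>lborel_Rn n)
      = (\<integral>\<^sup>+t. \<integral>\<^sup>+x. H (diff_Rn n x t) \<partial>lborel_Rn n \<partial>\<mu>)"
    using P.Fubini'[OF m] by simp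
  also have "\<dots> = (\<integral>\<^sup>+t. (\<integral>\<^sup>+x. H x \<partial>lborel_Rn n) \<partial>\<mu>)"
    by (intro nn_integral_cong nn_integral_lborel_Rn_diff H) (simp add: sp)
  also have "\<dots> = emeasure \<mu> (Rn n) * (\<integral>\<^sup>+x. H x \<partial>lborel_Rn n)"
    by (simp add: sp mult.commute)
  finally show "(\<integral>\<^sup>+x. \<integral>\<^sup>+t. H (diff_Rn n x t) \<partial>\<mu> \<partial>lborel_Rn n)
      = emeasure \<mu> (Rn n) * (\<integral>\<^sup>+x. H x \<partial>lborel_Rn n)" .
qed

section \<open>Gaussian integrals\<close>

text \<open>The integrand is a constant multiple of the centred normal density with standard
  deviation \<open>s\<close>, whose integral is 1.\<close>

lemma nn_integral_exp_square:
  assumes "s > 0"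
  shows "(\<integral>\<^sup>+x. ennreal (exp (- (x * x) / (2 * s\<^sup>2))) \<partial>lborel) = ennreal (sqrt (2 * pi) * s)"
proof -
  have eq: "exp (- (x * x) / (2 * s\<^sup>2)) = sqrt (2 * pi) * s * normal_density 0 s x" for x
    using assms by (simp add: normal_density_def real_sqrt_mult power2_eq_square)
  show ?thesis
    unfolding eq using assms
    by (simp add: nn_integral_eq_integral integral_normal_density integrable_normal_density)
qed

text \<open>The integrand factorizes over the coordinates. It is used with \<open>s = 1\<close> for
  \<open>gauss\<close> and with \<open>s = sqrt 2\<close> for \<open>wide_gauss\<close>.\<close>

lemma nn_integral_exp_inner_Rn:
  assumes "s > 0"
  shows "(\<integral>\<^sup>+x. ennreal (exp (- inner_Rn n x x / (2 * s\<^sup>2))) \<partial>lborel_Rn n) = ennreal ((sqrt (2 * pi) * s) ^ n)"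
proof -
  interpret product_sigma_finite "\<lambda>_::nat. lborel :: real measure" ..
  have eq: "ennreal (exp (- inner_Rn n x x / (2 * s\<^sup>2)))
      = (\<Prod>i<n. ennreal (exp (- (x i * x i) / (2 * s\<^sup>2))))" for x
    by (simp add: inner_Rn_def prod_ennreal sum_negf[symmetric] sum_divide_distrib exp_sum
        del: minus_mult_left minus_divide_left)
  have "(\<integral>\<^sup>+x. (\<Prod>i<n. ennreal (exp (- (x i * x i) / (2 * s\<^sup>2)))) \<partial>lborel_Rn n)
      = (\<Prod>i<n. \<integral>\<^sup>+y. ennreal (exp (- (y * y) / (2 * s\<^sup>2))) \<partial>lborel)"
    by (rule product_nn_integral_prod) auto
  also have "\<dots> = ennreal ((sqrt (2 * pi) * s) ^ n)"
    using assms by (simp only: nn_integral_exp_square) (simp add: ennreal_power)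
  finally show ?thesis unfolding eq .
qed

lemma mass_gauss: "mass n (gauss n) = ennreal (sqrt (2 * pi) ^ n)"
  using nn_integral_exp_inner_Rn[of 1 n] by (simp add: mass_def gauss_def)

text \<open>This is the sup-convolution of the Gaussian with itself, the supremum being attained at
  \<open>z = x / 2\<close>. Only the upper bound is proved; the closed form is visibly measurable
  and has an explicit mass.\<close>

definition wide_gauss :: "nat \<Rightarrow> (nat \<Rightarrow> real) \<Rightarrow> real" where
  "wide_gauss n x = exp (- inner_Rn n x x / 4)"

lemma measurable_wide_gauss [measurable]: "wide_gauss n \<in> borel_measurable (lborel_Rn n)"
  unfolding wide_gauss_def by measurable

lemma mass_wide_gauss: "mass n (wide_gauss n) = ennreal (sqrt (4 * pi) ^ n)"
proof -
  have "sqrt (4 * pi) = sqrt (2 * pi) * sqrt 2" by (simp add: real_sqrt_mult[symmetric])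
  then show ?thesis
    using nn_integral_exp_inner_Rn[of "sqrt 2" n] by (simp add: mass_def wide_gauss_def)
qed

lemma sup_conv_gauss_gauss_le:
  "ennreal (sup_conv n (gauss n) (gauss n) x) \<le> ennreal (wide_gauss n x)"
proof (rule sup_conv_least, rule ennreal_leI)
  fix z
  \<comment> \<open>The right side exceeds the left by
    \<open>(x i - 2 * z i)\<^sup>2 / 2\<close>.\<close>
  have "x i * x i / 2 \<le> z i * z i + (x i - z i) * (x i - z i)" for i
    using zero_le_square[of "x i - 2 * z i"] by (simp add: algebra_simps)
  then have "(\<Sum>i<n. x i * x i / 2) \<le> (\<Sum>i<n. z i * z i + (x i - z i) * (x i - z i))"
    by (rule sum_mono)
  then have "inner_Rn n x x / 2 \<le> inner_Rn n z z + inner_Rn n (diff_Rn n x z) (diff_Rn n x z)"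
    by (simp add: inner_Rn_def diff_Rn_def sum.distrib sum_divide_distrib)
  then show "gauss n z * gauss n (diff_Rn n x z) \<le> wide_gauss n x"
    by (simp add: gauss_def wide_gauss_def exp_add[symmetric])
qed

section \<open>Geometric log-concavity of the Gaussian and radial monotonicity\<close>

lemma continuous_map_inner_Rn: "continuous_map (top_Rn n) euclideanreal (\<lambda>x. inner_Rn n x x)"
  unfolding inner_Rn_def
  by (intro continuous_map_sum continuous_map_real_mult continuous_map_product_projection) auto

lemma usc_gauss: "usc_Rn n (gauss n)"
  unfolding usc_Rn_def
proof
  fix c
  have "continuous_map (top_Rn n) euclideanreal (gauss n)"
  proof -
    have "continuous_map euclideanreal euclideanreal (\<lambda>r. exp (- r / 2))"
      by (auto intro!: continuous_intros)
    from continuous_map_compose[OF continuous_map_inner_Rn this] show ?thesis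
      by (simp add: o_def gauss_def[abs_def])
  qed
  from openin_continuous_map_preimage[OF this, of "{..<c}"]
  show "openin (top_Rn n) {x \<in> Rn n. gauss n x < c}"
    by simp
qed

lemma convex_gauss: "convex_Rn n (\<lambda>x. neg_log (gauss n x))"
  unfolding convex_Rn_def
proof (intro ballI)
  fix x y and t :: real assume t: "t \<in> {0..1}"
  have nl: "neg_log (gauss n w) = ereal (inner_Rn n w w / 2)" for w
    by (simp add: neg_log_def gauss_def)
  let ?w = "add_Rn n (scale_Rn n (1 - t) x) (scale_Rn n t y)"
  have "((1 - t) * x i + t * y i) * ((1 - t) * x i + t * y i)
      \<le> (1 - t) * (x i * x i) + t * (y i * y i)" for i
  proof -
    \<comment> \<open>This product is exactly the gap in the convexity inequality for the
      square.\<close>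
    have "0 \<le> t * (1 - t) * ((x i - y i) * (x i - y i))" using t by simp
    then show ?thesis by (simp add: algebra_simps)
  qed
  then have "(\<Sum>i<n. ((1 - t) * x i + t * y i) * ((1 - t) * x i + t * y i))
      \<le> (\<Sum>i<n. (1 - t) * (x i * x i) + t * (y i * y i))"
    by (rule sum_mono)
  then have "inner_Rn n ?w ?w \<le> (1 - t) * inner_Rn n x x + t * inner_Rn n y y"
    by (simp add: inner_Rn_def add_Rn_def scale_Rn_def sum.distrib sum_distrib_left)
  then show "neg_log (gauss n ?w) \<le> ereal (1 - t) * neg_log (gauss n x) + ereal t * neg_log (gauss n y)"
    by (simp add: nl)
qed

text \<open>This admits the Gaussian itself as a test function in the volume condition.\<close>

lemma gauss_in_LCg: "gauss n \<in> LCg n"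
proof -
  have "gauss n (zero_Rn n) = 1" by (simp add: gauss_def inner_Rn_def zero_Rn_def)
  then show ?thesis
    using unit_valued_gauss[of n] usc_gauss convex_gauss
    by (simp add: LCg_def unit_valued_def mass_gauss)
qed

text \<open>The convex function \<open>- ln f\<close> vanishes at the origin, so its value at
  \<open>t x\<close> is at most \<open>t\<close> times its value at \<open>x\<close>; as it is
  non-negative, this is at most the value at \<open>x\<close>.\<close>

lemma LCg_radial_antimono:
  assumes f: "f \<in> LCg n" and x: "x \<in> Rn n" and t: "0 \<le> t" "t \<le> 1"
  shows "f x \<le> f (scale_Rn n t x)"
proof (cases "f x = 0")
  case True
  then show ?thesis using f by (simp add: LCg_def scale_Rn_in)
next
  case False
  have fx: "0 < f x" "f x \<le> 1" using f x False by (auto simp: LCg_def less_le)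
  have f0: "f (zero_Rn n) = 1" using f by (simp add: LCg_def)
  have "neg_log (f (add_Rn n (scale_Rn n (1 - t) (zero_Rn n)) (scale_Rn n t x)))
      \<le> ereal (1 - t) * neg_log (f (zero_Rn n)) + ereal t * neg_log (f x)"
  proof -
    have "convex_Rn n (\<lambda>x. neg_log (f x))" using f by (simp add: LCg_def)
    moreover have "t \<in> {0..1}" using t by simp
    ultimately show ?thesis using x zero_Rn_in[of n] unfolding convex_Rn_def by blast
  qed
  moreover have "add_Rn n (scale_Rn n (1 - t) (zero_Rn n)) (scale_Rn n t x) = scale_Rn n t x"
    by (auto simp: add_Rn_def scale_Rn_def zero_Rn_def)
  ultimately have le: "neg_log (f (scale_Rn n t x)) \<le> ereal (t * - ln (f x))"
    using fx f0 by (simp add: neg_log_def)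
  \<comment> \<open>A finite upper bound excludes the value \<open>\<infinity>\<close> that
    \<open>neg_log\<close> takes at 0.\<close>
  then have "f (scale_Rn n t x) \<noteq> 0" by (auto simp: neg_log_def)
  then have pos: "0 < f (scale_Rn n t x)"
    using f scale_Rn_in[of n t x] by (auto simp: LCg_def less_le)
  have "- ln (f (scale_Rn n t x)) \<le> t * - ln (f x)"
    using le pos by (simp add: neg_log_def)
  also have "\<dots> \<le> - ln (f x)"
    using fx t by (intro mult_left_le_one_le) (auto simp: ln_le_zero_iff)
  finally show ?thesis using pos fx by simp
qed

section \<open>Exchanging a factor for the Gaussian\<close>

lemma power_add_one_less:
  fixes C :: real
  assumes "C > 0" "n \<ge> 1"
  shows "C ^ n < (C + 1) ^ n"
  using assms by (intro power_strict_mono) auto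

text \<open>The infimum defining the covering number need not be attained. Enlarging
  \<open>C\<close> to \<open>C + 1\<close> leaves strict room for an actual measure; the room is
  strict only for \<open>n \<ge> 1\<close>, since both powers are 1 when
  \<open>n = 0\<close>.\<close>

lemma covering_obtain:
  assumes "covering_number n u (gauss n) \<le> ennreal (C ^ n)" "C > 0" "n \<ge> 1"
  obtains \<mu> where "sets \<mu> = sets (lborel_Rn n)" "emeasure \<mu> (Rn n) \<le> ennreal ((C + 1) ^ n)"
    "\<And>x. x \<in> Rn n \<Longrightarrow> ennreal (u x) \<le> (\<integral>\<^sup>+t. ennreal (gauss n (diff_Rn n x t)) \<partial>\<mu>)"
proof -
  have "covering_number n u (gauss n) < ennreal ((C + 1) ^ n)"
    using assms(1) power_add_one_less[OF assms(2,3)] assms(2)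
    by (meson ennreal_lessI le_less_trans zero_less_power add_pos_pos zero_less_one)
  then show ?thesis
    unfolding covering_number_def INF_less_iff using that by (auto intro: less_imp_le)
qed

text \<open>The conclusion has the same form as the hypothesis on \<open>H\<close>, a measurable
  majorant with controlled integral, so the exchange can be repeated on the other factor.\<close>

lemma covering_sup_conv_gauss_le:
  assumes u: "unit_valued n u" and cov: "covering_number n u (gauss n) \<le> ennreal (C ^ n)"
    and C: "C > 0" and n: "n \<ge> 1" and v: "unit_valued n v"
    and H: "H \<in> borel_measurable (lborel_Rn n)"
      "\<And>x. x \<in> Rn n \<Longrightarrow> ennreal (sup_conv n (gauss n) v x) \<le> H x"
  obtains H' where "H' \<in> borel_measurable (lborel_Rn n)"
    "\<And>x. x \<in> Rn n \<Longrightarrow> ennreal (sup_conv n u v x) \<le> H' x"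
    "(\<integral>\<^sup>+x. H' x \<partial>lborel_Rn n) \<le> ennreal ((C + 1) ^ n) * (\<integral>\<^sup>+x. H x \<partial>lborel_Rn n)"
proof -
  obtain \<mu> where \<mu>: "sets \<mu> = sets (lborel_Rn n)" "emeasure \<mu> (Rn n) \<le> ennreal ((C + 1) ^ n)"
    "\<And>x. x \<in> Rn n \<Longrightarrow> ennreal (u x) \<le> (\<integral>\<^sup>+t. ennreal (gauss n (diff_Rn n x t)) \<partial>\<mu>)"
    using covering_obtain[OF cov C n] by blast
  have fin: "emeasure \<mu> (Rn n) < \<infinity>"
    using \<mu>(2) by (simp add: order_le_less_trans)
  show ?thesis
  proof (rule that)
    show "(\<lambda>x. \<integral>\<^sup>+t. H (diff_Rn n x t) \<partial>\<mu>) \<in> borel_measurable (lborel_Rn n)"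
      by (rule measurable_convolution[OF \<mu>(1) fin H(1)])
    show "ennreal (sup_conv n u v x) \<le> (\<integral>\<^sup>+t. H (diff_Rn n x t) \<partial>\<mu>)" if "x \<in> Rn n" for x
      by (rule sup_conv_covering_le[OF \<mu>(1,3) u v H(2) that])
    show "(\<integral>\<^sup>+x. \<integral>\<^sup>+t. H (diff_Rn n x t) \<partial>\<mu> \<partial>lborel_Rn n)
        \<le> ennreal ((C + 1) ^ n) * (\<integral>\<^sup>+x. H x \<partial>lborel_Rn n)"
      unfolding nn_integral_convolution[OF \<mu>(1) fin H(1)] by (intro mult_right_mono \<mu>(2)) simp
  qed
qed

lemma mass_le_nn_integral:
  "(\<And>x. x \<in> Rn n \<Longrightarrow> ennreal (f x) \<le> H x) \<Longrightarrow> mass n f \<le> (\<integral>\<^sup>+x. H x \<partial>lborel_Rn n)"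
  unfolding mass_def by (intro nn_integral_mono) simp

text \<open>One exchange against the Gaussian, starting from \<open>wide_gauss\<close>. Commuting
  the factors puts the result in the form expected by a second exchange.\<close>

lemma covering_gauss_obtain:
  assumes u: "unit_valued n u" and cov: "covering_number n u (gauss n) \<le> ennreal (C ^ n)"
    and C: "C > 0" and n: "n \<ge> 1"
  obtains H where "H \<in> borel_measurable (lborel_Rn n)"
    "\<And>x. x \<in> Rn n \<Longrightarrow> ennreal (sup_conv n (gauss n) u x) \<le> H x"
    "(\<integral>\<^sup>+x. H x \<partial>lborel_Rn n) \<le> ennreal ((C + 1) ^ n) * ennreal (sqrt (4 * pi) ^ n)"
proof -
  have "(\<lambda>x. ennreal (wide_gauss n x)) \<in> borel_measurable (lborel_Rn n)" by measurable
  from covering_sup_conv_gauss_le[OF u cov C n unit_valued_gauss this sup_conv_gauss_gauss_le]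
  obtain H where "H \<in> borel_measurable (lborel_Rn n)"
    "\<And>x. x \<in> Rn n \<Longrightarrow> ennreal (sup_conv n u (gauss n) x) \<le> H x"
    "(\<integral>\<^sup>+x. H x \<partial>lborel_Rn n) \<le> ennreal ((C + 1) ^ n) * (\<integral>\<^sup>+x. ennreal (wide_gauss n x) \<partial>lborel_Rn n)"
    by blast
  with that show ?thesis
    using mass_wide_gauss[of n] by (simp add: mass_def sup_conv_commute[of _ n "gauss n"])
qed

text \<open>The constant is weakened to \<open>C + 1\<close> to agree with the cost in the covering
  case.\<close>

lemma mass_sup_conv_volume_le:
  assumes "M_volume n C u" "\<psi> \<in> LCg n" "C > 0"
  shows "mass n (sup_conv n u \<psi>) \<le> ennreal ((C + 1) ^ n) * mass n (sup_conv n (gauss n) \<psi>)"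
proof -
  have "mass n (sup_conv n u \<psi>) \<le> ennreal (C ^ n) * mass n (sup_conv n (gauss n) \<psi>)"
    using assms(1,2) unfolding M_volume_def by blast
  also have "\<dots> \<le> ennreal ((C + 1) ^ n) * mass n (sup_conv n (gauss n) \<psi>)"
    using assms(3) by (intro mult_right_mono ennreal_leI power_mono) auto
  finally show ?thesis .
qed

text \<open>One exchange reduces the mass to that of the Gaussian with itself, under either form of
  M-position.\<close>

lemma mass_sup_conv_gauss_M_position_le:
  assumes u: "M_position n C u" and C: "C > 0" and n: "n \<ge> 1"
  shows "mass n (sup_conv n (gauss n) u) \<le> ennreal ((C + 1) ^ n) * ennreal (sqrt (4 * pi) ^ n)"
proof -
  have uL: "u \<in> LCg n" using u by (simp add: M_position_def)
  consider "M_volume n C u" | "M_covering n C u" using u by (auto simp: M_position_def)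
  then show ?thesis
  proof cases
    case 1
    have "mass n (sup_conv n (gauss n) u) = mass n (sup_conv n u (gauss n))"
      by (rule mass_sup_conv_commute)
    also have "\<dots> \<le> ennreal ((C + 1) ^ n) * mass n (sup_conv n (gauss n) (gauss n))"
      by (rule mass_sup_conv_volume_le[OF 1 gauss_in_LCg C])
    also have "\<dots> \<le> ennreal ((C + 1) ^ n) * mass n (wide_gauss n)"
      unfolding mass_def by (intro mult_left_mono nn_integral_mono sup_conv_gauss_gauss_le) simp
    finally show ?thesis by (simp add: mass_wide_gauss)
  next
    case 2
    then have "covering_number n u (gauss n) \<le> ennreal (C ^ n)" by (simp add: M_covering_def)
    then obtain H where H: "\<And>x. x \<in> Rn n \<Longrightarrow> ennreal (sup_conv n (gauss n) u x) \<le> H x"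
      "(\<integral>\<^sup>+x. H x \<partial>lborel_Rn n) \<le> ennreal ((C + 1) ^ n) * ennreal (sqrt (4 * pi) ^ n)"
      using covering_gauss_obtain[OF LCg_unit_valued[OF uL] _ C n] by blast
    show ?thesis
      using mass_le_nn_integral[OF H(1)] H(2) by (rule order_trans)
  qed
qed

text \<open>Two exchanges cost \<open>(C + 1) ^ n\<close> each and leave the mass of
  \<open>wide_gauss\<close>.\<close>

lemma mass_sup_conv_M_position_le:
  assumes u: "M_position n C u" and v: "M_position n C v" and C: "C > 0" and n: "n \<ge> 1"
  shows "mass n (sup_conv n u v) \<le> ennreal (((C + 1)\<^sup>2 * sqrt (4 * pi)) ^ n)"
proof -
  let ?D = "ennreal ((C + 1) ^ n)"
  let ?K = "ennreal (sqrt (4 * pi) ^ n)"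
  have uL: "u \<in> LCg n" and vL: "v \<in> LCg n" using u v by (auto simp: M_position_def)
  \<comment> \<open>Stated for arbitrary \<open>u\<close> and \<open>v\<close> so that the roles can
    be swapped when only the second factor satisfies the volume condition.\<close>
  have vol: "mass n (sup_conv n u v) \<le> ?D * (?D * ?K)"
    if "M_volume n C u" "M_position n C v" for u v
  proof -
    have "v \<in> LCg n" using that(2) by (simp add: M_position_def)
    then have "mass n (sup_conv n u v) \<le> ?D * mass n (sup_conv n (gauss n) v)"
      by (rule mass_sup_conv_volume_le[OF that(1) _ C])
    also have "\<dots> \<le> ?D * (?D * ?K)"
      by (intro mult_left_mono mass_sup_conv_gauss_M_position_le that C n) simp
    finally show ?thesis .
  qed
  \<comment> \<open>The volume condition compares masses only and provides no pointwise majorant. In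
    a mixed pair it is therefore applied first, to the full sup-convolution; two covering conditions
    are chained through majorants.\<close>
  consider "M_volume n C u" | "M_volume n C v" | "M_covering n C u" "M_covering n C v"
    using u v by (auto simp: M_position_def)
  then have "mass n (sup_conv n u v) \<le> ?D * (?D * ?K)"
  proof cases
    case 1
    then show ?thesis using vol v by blast
  next
    case 2
    then show ?thesis using vol[OF 2 u] by (simp add: mass_sup_conv_commute)
  next
    case 3
    then have cov: "covering_number n u (gauss n) \<le> ennreal (C ^ n)"
      "covering_number n v (gauss n) \<le> ennreal (C ^ n)" by (auto simp: M_covering_def)
    obtain H where H: "H \<in> borel_measurable (lborel_Rn n)"
      "\<And>x. x \<in> Rn n \<Longrightarrow> ennreal (sup_conv n (gauss n) v x) \<le> H x"
      "(\<integral>\<^sup>+x. H x \<partial>lborel_Rn n) \<le> ?D * ?K"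
      using covering_gauss_obtain[OF LCg_unit_valued[OF vL] cov(2) C n] by blast
    obtain H' where H': "\<And>x. x \<in> Rn n \<Longrightarrow> ennreal (sup_conv n u v x) \<le> H' x"
      "(\<integral>\<^sup>+x. H' x \<partial>lborel_Rn n) \<le> ?D * (\<integral>\<^sup>+x. H x \<partial>lborel_Rn n)"
      using covering_sup_conv_gauss_le[OF LCg_unit_valued[OF uL] cov(1) C n
          LCg_unit_valued[OF vL] H(1,2)] by blast
    have "mass n (sup_conv n u v) \<le> (\<integral>\<^sup>+x. H' x \<partial>lborel_Rn n)"
      by (rule mass_le_nn_integral[OF H'(1)])
    also have "\<dots> \<le> ?D * (\<integral>\<^sup>+x. H x \<partial>lborel_Rn n)" by (rule H'(2))
    also have "\<dots> \<le> ?D * (?D * ?K)" by (intro mult_left_mono H(3)) simp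
    finally show ?thesis .
  qed
  also have "?D * (?D * ?K) = ennreal (((C + 1)\<^sup>2 * sqrt (4 * pi)) ^ n)"
    using C by (simp add: ennreal_mult[symmetric] power_mult_distrib power2_eq_square mult.assoc)
  finally show ?thesis .
qed

section \<open>Normalization and the final estimate\<close>

lemma norm_factor_pos:
  assumes "f \<in> LCg n"
  shows "0 < norm_factor n f"
proof -
  have "0 < enn2real (mass n f)"
    using assms by (simp add: LCg_def enn2real_positive_iff)
  then show ?thesis by (simp add: norm_factor_def)
qed

text \<open>This turns the reciprocal dilation factors into the \<open>n\<close>-th roots of the
  integrals in the final bound.\<close>

lemma mass_powr_eq_norm_factor:
  assumes "f \<in> LCg n" "n \<ge> 1"
  shows "enn2real (mass n f) powr (1 / real n) = sqrt (2 * pi) * (1 / norm_factor n f)"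
proof -
  let ?m = "enn2real (mass n f)"
  have m: "0 < ?m"
    using assms by (simp add: LCg_def enn2real_positive_iff)
  have "norm_factor n f = ((2 * pi) powr (real n / 2)) powr (1 / real n) / ?m powr (1 / real n)"
    unfolding norm_factor_def using m by (simp add: powr_divide)
  also have "((2 * pi) powr (real n / 2)) powr (1 / real n) = sqrt (2 * pi)"
    using assms(2) by (simp add: powr_powr powr_half_sqrt)
  finally show ?thesis using m norm_factor_pos[OF assms(1)] by (simp add: field_simps)
qed

text \<open>The right side is \<open>f\<close> at \<open>z / (s z_f)\<close>, and
  \<open>s \<ge> 1 / z_f\<close> makes this a contraction of \<open>z\<close> towards the
  origin.\<close>

lemma LCg_le_normalized:
  assumes f: "f \<in> LCg n" and s: "1 / norm_factor n f \<le> s" and z: "z \<in> Rn n"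
  shows "f z \<le> normalized n f (scale_Rn n (1 / s) z)"
proof -
  have a: "0 < 1 / norm_factor n f" using norm_factor_pos[OF f] by simp
  then have "0 < s" using s by linarith
  then show ?thesis
    unfolding normalized_def scale_Rn_scale_Rn using a s
    by (intro LCg_radial_antimono[OF f z]) (auto simp: field_simps)
qed

text \<open>A common \<open>s\<close> for both factors is essential: the scaled points
  \<open>z / s\<close> and \<open>(x - z) / s\<close> then still add up to
  \<open>x / s\<close>.\<close>

lemma sup_conv_le_normalized:
  assumes f: "f \<in> LCg n" and h: "h \<in> LCg n"
    and s: "1 / norm_factor n f \<le> s" "1 / norm_factor n h \<le> s"
    and ft: "unit_valued n (normalized n f)" and ht: "unit_valued n (normalized n h)"
  shows "sup_conv n f h x \<le> sup_conv n (normalized n f) (normalized n h) (scale_Rn n (1 / s) x)"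
  unfolding sup_conv_def[of n f]
proof (rule cSUP_least)
  show "Rn n \<noteq> {}" using zero_Rn_in by blast
  fix z assume z: "z \<in> Rn n"
  let ?S = "scale_Rn n (1 / s)"
  have "f z * h (diff_Rn n x z) \<le> normalized n f (?S z) * normalized n h (?S (diff_Rn n x z))"
    using f h ft z
    by (intro mult_mono LCg_le_normalized s diff_Rn_in)
      (auto simp: LCg_def unit_valued_def diff_Rn_in scale_Rn_in)
  also have "?S (diff_Rn n x z) = diff_Rn n (?S x) (?S z)"
    by (auto simp: scale_Rn_def diff_Rn_def diff_divide_distrib)
  also have "normalized n f (?S z) * normalized n h (diff_Rn n (?S x) (?S z))
      \<le> sup_conv n (normalized n f) (normalized n h) (?S x)"
    by (rule sup_conv_upper[OF ft ht scale_Rn_in])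
  finally show "f z * h (diff_Rn n x z)
      \<le> sup_conv n (normalized n f) (normalized n h) (scale_Rn n (1 / s) x)" .
qed

theorem proposition6p11:
  fixes C :: real
  assumes "C > 0"
  shows "\<exists>C'>0. \<forall>n\<ge>1. \<forall>f\<in>LCg n. \<forall>h\<in>LCg n.
    M_position n C (normalized n f) \<longrightarrow> M_position n C (normalized n h) \<longrightarrow>
    mass n (sup_conv n f h) < \<infinity> \<and>
    enn2real (mass n (sup_conv n f h)) powr (1 / real n)
      \<le> C' * (enn2real (mass n f) powr (1 / real n) + enn2real (mass n h) powr (1 / real n))"
proof -
  define K where "K = (C + 1)\<^sup>2 * sqrt (4 * pi)"
  have K: "K > 0" using assms by (simp add: K_def)
  show ?thesis
  \<comment> \<open>The \<open>n\<close>-th root will be at most \<open>(a + b) * K\<close>, where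
    \<open>sqrt (2 * pi) * a\<close> and \<open>sqrt (2 * pi) * b\<close> are the
    \<open>n\<close>-th roots of the two integrals. The constant equals
    \<open>sqrt 2 * (C + 1)\<^sup>2\<close>.\<close>
  proof (intro exI[of _ "K / sqrt (2 * pi)"] conjI allI ballI impI)
    show "K / sqrt (2 * pi) > 0" using K by simp
  next
    fix n :: nat and f h
    assume n: "n \<ge> 1" and f: "f \<in> LCg n" and h: "h \<in> LCg n"
      and fM: "M_position n C (normalized n f)" and hM: "M_position n C (normalized n h)"
    define a b where "a = 1 / norm_factor n f" and "b = 1 / norm_factor n h"
    have a: "a > 0" and b: "b > 0" using norm_factor_pos f h by (auto simp: a_def b_def)
    let ?F = "sup_conv n (normalized n f) (normalized n h)"
    \<comment> \<open>The common dilation \<open>s = a + b\<close> dominates both \<open>a\<close>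
      and \<open>b\<close>.\<close>
    have "mass n (sup_conv n f h) \<le> mass n (\<lambda>x. ?F (scale_Rn n (1 / (a + b)) x))"
      unfolding mass_def using a b fM hM
      by (intro nn_integral_mono ennreal_leI sup_conv_le_normalized f h)
        (auto simp: a_def[symmetric] b_def[symmetric] M_position_def LCg_unit_valued)
    also have "\<dots> \<le> ennreal ((a + b) ^ n) * mass n ?F"
      using a b by (intro mass_scale_le) simp
    also have "\<dots> \<le> ennreal ((a + b) ^ n) * ennreal (K ^ n)"
      unfolding K_def by (intro mult_left_mono mass_sup_conv_M_position_le fM hM assms n) simp
    also have "\<dots> = ennreal (((a + b) * K) ^ n)"
      using a b K by (simp add: ennreal_mult[symmetric] power_mult_distrib)
    finally have le: "mass n (sup_conv n f h) \<le> ennreal (((a + b) * K) ^ n)" .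
    \<comment> \<open>Since \<open>enn2real\<close> sends \<open>\<infinity>\<close> to 0, the real
      inequality has content only together with this finiteness.\<close>
    then show "mass n (sup_conv n f h) < \<infinity>"
      by (simp add: order_le_less_trans)
    have pos: "0 < (a + b) * K" using a b K by simp
    have "enn2real (mass n (sup_conv n f h)) \<le> ((a + b) * K) ^ n"
      using le pos by (simp add: enn2real_leI)
    then have "enn2real (mass n (sup_conv n f h)) powr (1 / real n)
        \<le> (((a + b) * K) ^ n) powr (1 / real n)"
      by (intro powr_mono2) auto
    also have "\<dots> = (a + b) * K"
      using pos n by (simp add: powr_realpow[symmetric] powr_powr)
    also have "\<dots> = K / sqrt (2 * pi) * (sqrt (2 * pi) * a + sqrt (2 * pi) * b)"
      by (simp add: field_simps)
    finally show "enn2real (mass n (sup_conv n f h)) powr (1 / real n)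
      \<le> K / sqrt (2 * pi) * (enn2real (mass n f) powr (1 / real n) + enn2real (mass n h) powr (1 / real n))"
      using mass_powr_eq_norm_factor[OF f n] mass_powr_eq_norm_factor[OF h n]
      by (simp add: a_def b_def)
  qed
qed

end
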